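(* Let $P\subset\mathbb{R}^d$ be a $d$-polytope and $Q\subset\mathbb{R}^e$ an $e$-polytope with $n$ vertices, both with vertex barycenter at the origin. The wreath product of the automorphism groups $\operatorname{Aut} P\wr\operatorname{Aut} Q=(\operatorname{Aut} P)^n\rtimes\operatorname{Aut} Q$ (where the semi-direct product is taken with respect to the natural action of $\operatorname{Aut} Q$ on the $n$ vertices of $Q$) acts as a group of automorphisms of the wreath product $P\wr Q$. In particular, if $\operatorname{Aut} P$ and $\operatorname{Aut} Q$ act transitively on the set of vertices of $P$ and of $Q$, respectively, then $P\wr Q$ also admits a vertex-transitive group of automorphisms.
   Context: Polytopes are convex polytopes; a $d$-polytope is a polytope of dimension $d$, and the vertex barycenter is the average of the vertices. $\operatorname{Aut}$ denotes the group of (combinatorial) automorphisms, i.e. automorphisms of the face lattice, viewed as permutations of the vertices. Wreath product of polytopes: identify $\mathbb{R}^{nd}$ with the set of real $n\times d$ matrices. For $k\in\{1,\dots,n\}$ and $p\in\mathbb{R}^d$ let $p^k\in\mathbb{R}^{nd}$ be the matrix whose $k$-th row is $p$ and all of whose other rows are zero; for $x\in\mathbb{R}^{nd}$, $y\in\mathbb{R}^e$, $x\oplus y\in\mathbb{R}^{nd+e}$ is the concatenated vector. If $v_1,\dots,v_m$ are the vertices of $P$ and $w_1,\dots,w_n$ those of $Q$, then $$P\wr Q=\operatorname{conv}\{(v_i)^k\oplus w_k : 1\le i\le m,\ 1\le k\le n\}\subset\mathbb{R}^{nd+e},$$ which is a full-dimensional polytope whose vertices are the $mn$ points $(v_i)^k\oplus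 w_k$. The action on vertices is the natural one: the $k$-th factor of $(\operatorname{Aut}P)^n$ acts on the index $i$ of the vertices $(v_i)^k\oplus w_k$ with that fixed $k$, and $\operatorname{Aut}Q$ acts on the index $k$. *)

theory Defs
  imports "HOL-Analysis.Analysis" "HOL-Algebra.Group_Action" "HOL-Algebra.Product_Groups"
begin

definition vertices :: "'a::real_vector set \<Rightarrow> 'a set" where
  "vertices P = {v. v extreme_point_of P}"

definition vertex_barycenter :: "'a::real_vector set \<Rightarrow> 'a" where
  "vertex_barycenter P = (1 / real (card (vertices P))) *\<^sub>R (\<Sum>v\<in>vertices P. v)"

text \<open>The face lattice contains the empty face and \<open>P\<close> itself, as both satisfy \<open>face_of\<close>.\<close>

definition face_lattice_automorphism ::
    "'a::real_vector set \<Rightarrow> ('a set \<Rightarrow> 'a set) \<Rightarrow> bool" where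
  "face_lattice_automorphism P \<Phi> \<longleftrightarrow>
     bij_betw \<Phi> {F. F face_of P} {F. F face_of P} \<and>
     (\<forall>F G. F face_of P \<longrightarrow> G face_of P \<longrightarrow> (F \<subseteq> G \<longleftrightarrow> \<Phi> F \<subseteq> \<Phi> G))"

text \<open>Combinatorial automorphisms viewed as permutations of the vertices: the vertices \<open>v\<close> of
  \<open>P\<close> correspond to the faces \<open>{v}\<close>. As in \<open>BijGroup\<close>, permutations of the vertex
  set are extensional functions, and the product is composition.\<close>

definition aut_group :: "'a::real_vector set \<Rightarrow> ('a \<Rightarrow> 'a) monoid" where
  "aut_group P = BijGroup (vertices P)
     \<lparr>carrier := {\<pi> \<in> Bij (vertices P).
        \<exists>\<Phi>. face_lattice_automorphism P \<Phi> \<and> (\<forall>v\<in>vertices P. \<Phi> {v} = {\<pi> v})}\<rparr>"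

definition semidirect_product ::
    "('a, 'c) monoid_scheme \<Rightarrow> ('b, 'd) monoid_scheme \<Rightarrow> ('b \<Rightarrow> 'a \<Rightarrow> 'a) \<Rightarrow> ('a \<times> 'b) monoid"
  where
  "semidirect_product N H \<theta> =
     \<lparr>carrier = carrier N \<times> carrier H,
      mult = (\<lambda>(a, h) (b, k). (a \<otimes>\<^bsub>N\<^esub> \<theta> h b, h \<otimes>\<^bsub>H\<^esub> k)),
      one = (\<one>\<^bsub>N\<^esub>, \<one>\<^bsub>H\<^esub>)\<rparr>"

text \<open>Throughout, \<open>w :: 'n \<Rightarrow> _\<close> enumerates the vertices of \<open>Q\<close> without repetition, so
  \<open>'n\<close> plays the role of \<open>{1..n}\<close>.\<close>

definition index_perm :: "('n \<Rightarrow> 'b) \<Rightarrow> ('b \<Rightarrow> 'b) \<Rightarrow> 'n \<Rightarrow> 'n" where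
  "index_perm w h = (\<lambda>k. inv_into UNIV w (h (w k)))"

text \<open>\<open>h\<close> moves the entry at position \<open>k\<close> of a tuple to position \<open>index_perm w h k\<close>,
  hence the inverse in the coordinate formula.\<close>

definition wreath_group ::
    "'a::real_vector set \<Rightarrow> ('n \<Rightarrow> 'b) \<Rightarrow> 'b::real_vector set
      \<Rightarrow> (('n \<Rightarrow> 'a \<Rightarrow> 'a) \<times> ('b \<Rightarrow> 'b)) monoid" where
  "wreath_group P w Q =
     semidirect_product (product_group UNIV (\<lambda>_. aut_group P)) (aut_group Q)
       (\<lambda>h g k. g (inv_into UNIV (index_perm w h) k))"

text \<open>The type \<open>real ^ 'd ^ 'n\<close> consists of the matrices with rows in \<open>real ^ 'd\<close> indexed by
  \<open>'n\<close>; \<open>axis k v\<close> has \<open>k\<close>-th row \<open>v\<close> and zeros elsewhere. Pairing plays the role of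
  the concatenation of vectors.\<close>

definition wreath_vertex ::
    "('n \<Rightarrow> real ^ 'e) \<Rightarrow> 'n \<Rightarrow> real ^ 'd \<Rightarrow> (real ^ 'd ^ 'n) \<times> (real ^ 'e)" where
  "wreath_vertex w k v = (axis k v, w k)"

definition wreath_polytope ::
    "(real ^ 'd) set \<Rightarrow> ('n \<Rightarrow> real ^ 'e) \<Rightarrow> ((real ^ 'd ^ 'n) \<times> (real ^ 'e)) set" where
  "wreath_polytope P w = convex hull {wreath_vertex w k v | v k. v \<in> vertices P}"

end

theory Submission
  imports Defs
begin

text \<open>A face of a polytope is identified with its vertex set, which is cut out by a supporting
  functional. A functional on the ambient space of \<open>P \<wr> Q\<close> consists of one functional \<open>a\<^sub>k\<close> on
  the space of \<open>P\<close> for each vertex \<open>w k\<close> of \<open>Q\<close> and one functional \<open>b\<close> on the space of \<open>Q\<close>, and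
  it supports \<open>P \<wr> Q\<close> at level \<open>c\<close> iff \<open>a\<^sub>k \<bullet> v \<le> c - b \<bullet> w k\<close> throughout. As the vertices of \<open>P\<close>
  sum to zero, \<open>c - b \<bullet> w k\<close> is nonnegative, and it vanishes iff the whole \<open>k\<close>-th copy of \<open>P\<close> is
  selected. Hence a set of vertices of \<open>P \<wr> Q\<close> is a face iff each of its fibres is a face of \<open>P\<close>
  and the full fibres form a face of \<open>Q\<close>. The wreath product action preserves this condition.\<close>

section \<open>Vertex sets of faces\<close>

text \<open>Working with vertex sets lets a vertex permutation act on faces simply by taking images.
  The empty set and the set of all vertices are included, as they come from the empty face and from
  \<open>R\<close> itself.\<close>

definition facial :: "'a::real_vector set \<Rightarrow> 'a set \<Rightarrow> bool" where
  "facial R S \<longleftrightarrow> (\<exists>F. F face_of R \<and> S = F \<inter> vertices R)"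

lemma finite_vertices: "polytope (R :: 'a::euclidean_space set) \<Longrightarrow> finite (vertices R)"
  unfolding vertices_def by (simp add: finite_polyhedron_extreme_points polytope_imp_polyhedron)

lemma convex_hull_vertices: "polytope (R :: 'a::euclidean_space set) \<Longrightarrow> convex hull (vertices R) = R"
  unfolding vertices_def
  using Krein_Milman_Minkowski polytope_imp_compact polytope_imp_convex by metis

text \<open>The extreme points of a face are the extreme points of \<open>R\<close> lying in it, and
  a face of a polytope is again a polytope, hence the hull of its own extreme points.\<close>

lemma face_eq_convex_hull_vertices:
  fixes R :: "'a::euclidean_space set"
  assumes "polytope R" "F face_of R"
  shows "convex hull (F \<inter> vertices R) = F"
proof -
  have "vertices F = F \<inter> vertices R"
    using extreme_point_of_face[OF assms(2)] by (auto simp: vertices_def)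
  then show ?thesis
    using convex_hull_vertices face_of_polytope_polytope assms by metis
qed

lemma face_subset_iff_vertices:
  fixes R :: "'a::euclidean_space set"
  assumes "polytope R" "F face_of R" "G face_of R"
  shows "F \<subseteq> G \<longleftrightarrow> F \<inter> vertices R \<subseteq> G \<inter> vertices R"
  using face_eq_convex_hull_vertices[OF assms(1)] assms(2,3) hull_mono[of _ _ convex]
  by (metis Int_mono subset_refl)

text \<open>Faces of polytopes are exposed; conversely an inequality on the vertices extends to
  their hull. The functional \<open>a = 0\<close> is allowed: it yields all vertices at level
  \<open>c = 0\<close> and the empty set at any level \<open>c > 0\<close>.\<close>

lemma facial_iff_supporting:
  fixes R :: "'a::euclidean_space set"
  assumes "polytope R"
  shows "facial R S \<longleftrightarrow>
    (\<exists>a c. (\<forall>v\<in>vertices R. a \<bullet> v \<le> c) \<and> S = {v\<in>vertices R. a \<bullet> v = c})"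
proof
  assume "facial R S"
  then obtain F where F: "F face_of R" "S = F \<inter> vertices R"
    by (auto simp: facial_def)
  then have "F exposed_face_of R"
    using exposed_face_of_polyhedron polytope_imp_polyhedron assms by blast
  then obtain a c where "R \<subseteq> {x. a \<bullet> x \<le> c}" "F = R \<inter> {x. a \<bullet> x = c}"
    by (auto simp: exposed_face_of_def)
  moreover have "vertices R \<subseteq> R"
    by (auto simp: vertices_def extreme_point_of_def)
  ultimately show "\<exists>a c. (\<forall>v\<in>vertices R. a \<bullet> v \<le> c) \<and> S = {v\<in>vertices R. a \<bullet> v = c}"
    using F by (intro exI[of _ a] exI[of _ c]) auto
next
  assume "\<exists>a c. (\<forall>v\<in>vertices R. a \<bullet> v \<le> c) \<and> S = {v\<in>vertices R. a \<bullet> v = c}"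
  then obtain a c where ac: "\<forall>v\<in>vertices R. a \<bullet> v \<le> c" "S = {v\<in>vertices R. a \<bullet> v = c}"
    by auto
  have "convex hull (vertices R) \<subseteq> {x. a \<bullet> x \<le> c}"
    using ac by (intro hull_minimal) (auto simp: convex_halfspace_le)
  then have "R \<subseteq> {x. a \<bullet> x \<le> c}"
    by (simp add: convex_hull_vertices assms)
  then have "(R \<inter> {x. a \<bullet> x = c}) face_of R"
    using face_of_Int_supporting_hyperplane_le polytope_imp_convex assms by blast
  moreover have "S = (R \<inter> {x. a \<bullet> x = c}) \<inter> vertices R"
    using ac by (auto simp: vertices_def extreme_point_of_def)
  ultimately show "facial R S"
    by (auto simp: facial_def)
qed

lemma facial_singleton: "v \<in> vertices R \<Longrightarrow> facial R {v}"
  unfolding facial_def using face_of_singleton[of v R]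
  by (intro exI[of _ "{v}"]) (auto simp: vertices_def)

text \<open>The points maximising \<open>a\<close> form a nonempty face. Being a polytope, this face
  has a vertex; every vertex of the hull comes from \<open>W\<close>, and \<open>x\<close> is the
  only point of \<open>W\<close> on the face.\<close>

lemma extreme_point_of_convex_hull_if_strict_maximum:
  fixes W :: "'a::euclidean_space set"
  assumes "finite W" "x \<in> W" and less: "\<And>y. y \<in> W \<Longrightarrow> y \<noteq> x \<Longrightarrow> a \<bullet> y < a \<bullet> x"
  shows "x extreme_point_of (convex hull W)"
proof -
  let ?T = "convex hull W \<inter> {y. a \<bullet> y = a \<bullet> x}"
  have "convex hull W \<subseteq> {y. a \<bullet> y \<le> a \<bullet> x}"
    using less by (intro hull_minimal) (force simp: convex_halfspace_le)+
  then have T: "?T face_of (convex hull W)"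
    by (intro face_of_Int_supporting_hyperplane_le) auto
  have W: "polytope (convex hull W)"
    using assms by (auto simp: polytope_def)
  have "vertices (convex hull W) \<subseteq> W"
    by (auto simp: vertices_def dest: extreme_point_of_convex_hull)
  then have "?T \<inter> vertices (convex hull W) \<subseteq> {x}"
    using less by force
  moreover have "?T \<noteq> {}"
    using assms hull_inc by fastforce
  then have "?T \<inter> vertices (convex hull W) \<noteq> {}"
    using face_eq_convex_hull_vertices[OF W T] by force
  ultimately show ?thesis
    by (auto simp: vertices_def)
qed

section \<open>The automorphism group\<close>

text \<open>Faces and their vertex sets determine each other compatibly with inclusion, so a lattice
  automorphism extending \<open>\<pi>\<close> must send \<open>F\<close> to the face spanned by the
  images of the vertices of \<open>F\<close>. This removes the map on faces from the definition of
  the group.\<close>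

lemma aut_group_carrier_iff:
  fixes R :: "'a::euclidean_space set"
  assumes R: "polytope R"
  shows "\<pi> \<in> carrier (aut_group R) \<longleftrightarrow>
    \<pi> \<in> Bij (vertices R) \<and> (\<forall>S\<subseteq>vertices R. facial R (\<pi> ` S) \<longleftrightarrow> facial R S)"
proof
  let ?V = "vertices R"
  assume "\<pi> \<in> carrier (aut_group R)"
  then obtain \<Phi> where \<pi>: "\<pi> \<in> Bij ?V" and \<Phi>: "face_lattice_automorphism R \<Phi>"
    and v: "\<And>v. v \<in> ?V \<Longrightarrow> \<Phi> {v} = {\<pi> v}"
    by (auto simp: aut_group_def)
  have bij: "bij_betw \<pi> ?V ?V"
    using \<pi> by (auto simp: Bij_def)
  have img: "\<Phi> F \<inter> ?V = \<pi> ` (F \<inter> ?V)" if F: "F face_of R" for F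
  proof -
    \<comment> \<open>Membership of a vertex is an order relation between faces, namely
      \<open>{u} \<subseteq> F\<close>, and is therefore preserved and reflected by
      \<open>\<Phi>\<close>.\<close>
    have mem: "u \<in> F \<longleftrightarrow> \<pi> u \<in> \<Phi> F" if "u \<in> ?V" for u
    proof -
      have "{u} face_of R"
        using that face_of_singleton by (auto simp: vertices_def)
      then have "{u} \<subseteq> F \<longleftrightarrow> \<Phi> {u} \<subseteq> \<Phi> F"
        using \<Phi> F unfolding face_lattice_automorphism_def by blast
      then show ?thesis using v that by simp
    qed
    have onto: "\<pi> ` ?V = ?V"
      using bij by (simp add: bij_betw_def)
    show ?thesis
    proof
      show "\<pi> ` (F \<inter> ?V) \<subseteq> \<Phi> F \<inter> ?V"
        using mem onto by auto
      show "\<Phi> F \<inter> ?V \<subseteq> \<pi> ` (F \<inter> ?V)"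
      proof
        fix x assume x: "x \<in> \<Phi> F \<inter> ?V"
        then obtain u where "u \<in> ?V" "x = \<pi> u"
          using onto by (metis IntD2 imageE)
        then show "x \<in> \<pi> ` (F \<inter> ?V)"
          using x mem by auto
      qed
    qed
  qed
  have onto: "\<Phi> ` {F. F face_of R} = {F. F face_of R}"
    using \<Phi> by (simp add: face_lattice_automorphism_def bij_betw_def)
  have "facial R (\<pi> ` S) \<longleftrightarrow> facial R S" if S: "S \<subseteq> ?V" for S
  proof
    assume "facial R S"
    then obtain F where "F face_of R" "S = F \<inter> ?V" by (auto simp: facial_def)
    then show "facial R (\<pi> ` S)"
      using img[of F] onto unfolding facial_def by blast
  next
    assume "facial R (\<pi> ` S)"
    then obtain G where G: "G face_of R" "\<pi> ` S = G \<inter> ?V" by (auto simp: facial_def)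
    then obtain F where F: "F face_of R" "G = \<Phi> F" using onto by blast
    then have "\<pi> ` S = \<pi> ` (F \<inter> ?V)" using G img by simp
    then have "S = F \<inter> ?V"
      using S bij by (meson bij_betw_def inf_le2 inj_on_image_eq_iff)
    then show "facial R S" using F by (auto simp: facial_def)
  qed
  then show "\<pi> \<in> Bij ?V \<and> (\<forall>S\<subseteq>?V. facial R (\<pi> ` S) \<longleftrightarrow> facial R S)"
    using \<pi> by blast
next
  let ?V = "vertices R"
  assume *: "\<pi> \<in> Bij ?V \<and> (\<forall>S\<subseteq>?V. facial R (\<pi> ` S) \<longleftrightarrow> facial R S)"
  then have \<pi>: "bij_betw \<pi> ?V ?V" and fac: "\<And>S. S \<subseteq> ?V \<Longrightarrow> facial R (\<pi> ` S) \<longleftrightarrow> facial R S"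
    by (auto simp: Bij_def)
  \<comment> \<open>The only candidate for the extension: the face whose vertices are the images of
    those of \<open>F\<close>, written as the hull of these vertices.\<close>
  define \<Phi> where "\<Phi> = (\<lambda>F. convex hull (\<pi> ` (F \<inter> ?V)))"
  have hull: "(convex hull S) face_of R \<and> (convex hull S) \<inter> ?V = S" if "facial R S" for S
    using that face_eq_convex_hull_vertices[OF R] by (auto simp: facial_def)
  have faces: "\<Phi> F face_of R \<and> \<Phi> F \<inter> ?V = \<pi> ` (F \<inter> ?V)" if "F face_of R" for F
  proof -
    have "facial R (F \<inter> ?V)"
      using that unfolding facial_def by blast
    then have "facial R (\<pi> ` (F \<inter> ?V))"
      by (simp add: fac)
    then show ?thesis
      unfolding \<Phi>_def by (rule hull)
  qed
  have inj: "inj_on \<pi> ?V"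
    using \<pi> by (simp add: bij_betw_def)
  have mono: "F \<subseteq> G \<longleftrightarrow> \<Phi> F \<subseteq> \<Phi> G" if F: "F face_of R" and G: "G face_of R" for F G
  proof -
    have "F \<subseteq> G \<longleftrightarrow> F \<inter> ?V \<subseteq> G \<inter> ?V"
      by (rule face_subset_iff_vertices[OF R F G])
    also have "\<dots> \<longleftrightarrow> \<pi> ` (F \<inter> ?V) \<subseteq> \<pi> ` (G \<inter> ?V)"
      using inj_on_image_subset_iff[OF inj, of "F \<inter> ?V" "G \<inter> ?V"] by simp
    also have "\<dots> \<longleftrightarrow> \<Phi> F \<subseteq> \<Phi> G"
      using face_subset_iff_vertices[OF R, of "\<Phi> F" "\<Phi> G"] faces F G by simp
    finally show ?thesis .
  qed
  have "G \<in> \<Phi> ` {F. F face_of R}" if G: "G face_of R" for G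
  proof -
    \<comment> \<open>The preimage of \<open>G\<close> is spanned by \<open>S\<close>, the preimage
      of its vertex set under \<open>\<pi>\<close>. That \<open>S\<close> is again facial uses the
      backward direction of the equivalence in the assumption.\<close>
    obtain S where S: "S \<subseteq> ?V" "\<pi> ` S = G \<inter> ?V"
      using \<pi> by (metis bij_betw_def inf_le2 subset_imageE)
    then have "facial R S"
      using G fac[of S] by (auto simp: facial_def)
    then have h: "(convex hull S) face_of R" "(convex hull S) \<inter> ?V = S"
      using hull by auto
    then have "\<Phi> (convex hull S) = G"
      using S face_eq_convex_hull_vertices[OF R G] by (simp add: \<Phi>_def)
    then show ?thesis using h by blast
  qed
  then have "\<Phi> ` {F. F face_of R} = {F. F face_of R}"
    using faces by auto
  moreover have "inj_on \<Phi> {F. F face_of R}"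
    using mono by (intro inj_onI) (metis equalityE mem_Collect_eq subset_antisym)
  ultimately have "face_lattice_automorphism R \<Phi>"
    using mono by (auto simp: face_lattice_automorphism_def bij_betw_def)
  moreover have "\<Phi> {v} = {\<pi> v}" if "v \<in> ?V" for v
    using that by (simp add: \<Phi>_def)
  ultimately show "\<pi> \<in> carrier (aut_group R)"
    using * by (auto simp: aut_group_def)
qed

text \<open>Preserving facial sets in both directions is stable under composition, and stability
  under inverses follows by applying the condition for \<open>\<pi>\<close> to the image of
  \<open>S\<close> under the inverse.\<close>

lemma subgroup_aut_group:
  fixes R :: "'a::euclidean_space set"
  assumes R: "polytope R"
  shows "subgroup (carrier (aut_group R)) (BijGroup (vertices R))"
proof -
  let ?V = "vertices R"
  interpret B: group "BijGroup ?V" by (rule group_BijGroup)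
  have image: "\<pi> ` S \<subseteq> ?V" if "\<pi> \<in> Bij ?V" "S \<subseteq> ?V" for \<pi> S
    using Bij_imp_funcset[OF that(1)] that(2) by blast
  show ?thesis
  proof (rule B.subgroupI)
    show "carrier (aut_group R) \<subseteq> carrier (BijGroup ?V)"
      by (auto simp: aut_group_def BijGroup_def)
    have "(\<lambda>x\<in>?V. x) ` S = S" if "S \<subseteq> ?V" for S
      using that by force
    then have "(\<lambda>x\<in>?V. x) \<in> carrier (aut_group R)"
      by (simp add: aut_group_carrier_iff[OF R] id_Bij)
    then show "carrier (aut_group R) \<noteq> {}" by blast
  next
    fix \<pi> assume "\<pi> \<in> carrier (aut_group R)"
    then have \<pi>: "\<pi> \<in> Bij ?V" and fac: "\<And>S. S \<subseteq> ?V \<Longrightarrow> facial R (\<pi> ` S) \<longleftrightarrow> facial R S"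
      by (auto simp: aut_group_carrier_iff[OF R])
    let ?\<rho> = "\<lambda>x\<in>?V. inv_into ?V \<pi> x"
    have \<rho>: "?\<rho> \<in> Bij ?V" by (rule restrict_inv_into_Bij[OF \<pi>])
    have "facial R (?\<rho> ` S) \<longleftrightarrow> facial R S" if S: "S \<subseteq> ?V" for S
    proof -
      have "\<pi> (?\<rho> x) = x" if "x \<in> S" for x
        using that S \<pi> by (auto simp: Bij_def bij_betw_def f_inv_into_f)
      then have "(\<lambda>x. \<pi> (?\<rho> x)) ` S = (\<lambda>x. x) ` S"
        by (rule image_cong[OF refl])
      then have "\<pi> ` (?\<rho> ` S) = S"
        by (simp only: image_image image_ident)
      then show ?thesis using fac[OF image[OF \<rho> S]] by simp
    qed
    then have "?\<rho> \<in> carrier (aut_group R)"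
      using \<rho> by (simp add: aut_group_carrier_iff[OF R])
    then show "inv\<^bsub>BijGroup ?V\<^esub> \<pi> \<in> carrier (aut_group R)"
      by (simp add: inv_BijGroup[OF \<pi>])
  next
    fix \<pi> \<rho> assume "\<pi> \<in> carrier (aut_group R)" "\<rho> \<in> carrier (aut_group R)"
    then have \<pi>: "\<pi> \<in> Bij ?V" "\<And>S. S \<subseteq> ?V \<Longrightarrow> facial R (\<pi> ` S) \<longleftrightarrow> facial R S"
      and \<rho>: "\<rho> \<in> Bij ?V" "\<And>S. S \<subseteq> ?V \<Longrightarrow> facial R (\<rho> ` S) \<longleftrightarrow> facial R S"
      by (auto simp: aut_group_carrier_iff[OF R])
    have "facial R (compose ?V \<pi> \<rho> ` S) \<longleftrightarrow> facial R S" if S: "S \<subseteq> ?V" for S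
    proof -
      have "compose ?V \<pi> \<rho> ` S = \<pi> ` (\<rho> ` S)"
        unfolding image_image by (rule image_cong[OF refl]) (use S in \<open>auto simp: compose_def\<close>)
      then show ?thesis
        using \<pi>(2)[OF image[OF \<rho>(1) S]] \<rho>(2)[OF S] by simp
    qed
    then show "\<pi> \<otimes>\<^bsub>BijGroup ?V\<^esub> \<rho> \<in> carrier (aut_group R)"
      using \<pi>(1) \<rho>(1) compose_Bij
      by (simp add: aut_group_carrier_iff[OF R] BijGroup_def)
  qed
qed

lemma aut_group_eq: "aut_group R = BijGroup (vertices R)\<lparr>carrier := carrier (aut_group R)\<rparr>"
  by (simp add: aut_group_def)

lemma group_aut_group: "polytope (R :: 'a::euclidean_space set) \<Longrightarrow> group (aut_group R)"
  by (metis aut_group_eq group.subgroup_imp_group group_BijGroup subgroup_aut_group)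

lemma aut_group_subset_Bij: "\<pi> \<in> carrier (aut_group R) \<Longrightarrow> \<pi> \<in> Bij (vertices R)"
  by (auto simp: aut_group_def)

lemma mult_aut_group:
  "\<pi> \<in> carrier (aut_group R) \<Longrightarrow> \<rho> \<in> carrier (aut_group R) \<Longrightarrow>
    \<pi> \<otimes>\<^bsub>aut_group R\<^esub> \<rho> = compose (vertices R) \<pi> \<rho>"
  by (auto simp: aut_group_def BijGroup_def)

lemma one_aut_group: "\<one>\<^bsub>aut_group R\<^esub> = (\<lambda>x\<in>vertices R. x)"
  by (simp add: aut_group_def BijGroup_def)

lemma aut_group_mem: "\<pi> \<in> carrier (aut_group R) \<Longrightarrow> v \<in> vertices R \<Longrightarrow> \<pi> v \<in> vertices R"
  using aut_group_subset_Bij Bij_imp_funcset by blast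

lemma aut_group_image: "\<pi> \<in> carrier (aut_group R) \<Longrightarrow> \<pi> ` vertices R = vertices R"
  using aut_group_subset_Bij[of \<pi> R] by (auto simp: Bij_def bij_betw_def)

lemma aut_group_inj: "\<pi> \<in> carrier (aut_group R) \<Longrightarrow> inj_on \<pi> (vertices R)"
  using aut_group_subset_Bij[of \<pi> R] by (auto simp: Bij_def bij_betw_def)

section \<open>Semidirect products\<close>

lemma group_semidirect_product:
  assumes "group N" "group H"
    and hom: "\<And>h. h \<in> carrier H \<Longrightarrow> \<theta> h \<in> hom N N"
    and one: "\<And>a. a \<in> carrier N \<Longrightarrow> \<theta> \<one>\<^bsub>H\<^esub> a = a"
    and mult: "\<And>h k a. h \<in> carrier H \<Longrightarrow> k \<in> carrier H \<Longrightarrow> a \<in> carrier N \<Longrightarrow>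
      \<theta> (h \<otimes>\<^bsub>H\<^esub> k) a = \<theta> h (\<theta> k a)"
  shows "group (semidirect_product N H \<theta>)"
proof -
  interpret N: group N by fact
  interpret H: group H by fact
  have closed: "\<theta> h a \<in> carrier N" if "h \<in> carrier H" "a \<in> carrier N" for h a
    using hom that by (auto simp: hom_def)
  have hmult: "\<theta> h (a \<otimes>\<^bsub>N\<^esub> b) = \<theta> h a \<otimes>\<^bsub>N\<^esub> \<theta> h b"
    if "h \<in> carrier H" "a \<in> carrier N" "b \<in> carrier N" for h a b
    using hom that by (auto simp: hom_def)
  have hone: "\<theta> h \<one>\<^bsub>N\<^esub> = \<one>\<^bsub>N\<^esub>" if "h \<in> carrier H" for h
    using hom_one[OF hom[OF that]] N.is_group by simp
  show ?thesis
  proof (rule groupI)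
    fix x assume "x \<in> carrier (semidirect_product N H \<theta>)"
    then obtain a h where x: "x = (a, h)" "a \<in> carrier N" "h \<in> carrier H"
      by (auto simp: semidirect_product_def)
    \<comment> \<open>It suffices to exhibit a left inverse of \<open>(a, h)\<close>. Its second
      entry must be the inverse of \<open>h\<close>, and its first entry is then forced to be the
      inverse of \<open>a\<close> twisted by that element.\<close>
    have "\<theta> (inv\<^bsub>H\<^esub> h) (inv\<^bsub>N\<^esub> a) \<otimes>\<^bsub>N\<^esub> \<theta> (inv\<^bsub>H\<^esub> h) a = \<one>\<^bsub>N\<^esub>"
      using x hmult[of "inv\<^bsub>H\<^esub> h" "inv\<^bsub>N\<^esub> a" a] hone by simp
    then show "\<exists>y\<in>carrier (semidirect_product N H \<theta>).
        y \<otimes>\<^bsub>semidirect_product N H \<theta>\<^esub> x = \<one>\<^bsub>semidirect_product N H \<theta>\<^esub>"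
      using x closed
      by (intro bexI[of _ "(\<theta> (inv\<^bsub>H\<^esub> h) (inv\<^bsub>N\<^esub> a), inv\<^bsub>H\<^esub> h)"])
         (auto simp: semidirect_product_def)
  qed (auto simp: semidirect_product_def closed one mult hmult N.m_assoc H.m_assoc)
qed

section \<open>Wreath products of polytopes\<close>

text \<open>The values \<open>a \<bullet> v\<close> sum to zero, so \<open>c\<close> is the average
  of the nonnegative slacks \<open>c - a \<bullet> v\<close>. Such an average is nonnegative and
  vanishes only if every slack does. The barycenter condition on \<open>P\<close> takes effect
  through this lemma.\<close>

lemma supporting_level_if_sum_zero:
  fixes V :: "'a::real_inner set"
  assumes "finite V" "V \<noteq> {}" "(\<Sum>v\<in>V. v) = 0" "\<forall>v\<in>V. a \<bullet> v \<le> c"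
  shows "0 \<le> c" and "c = 0 \<longleftrightarrow> (\<forall>v\<in>V. a \<bullet> v = c)"
proof -
  have "(\<Sum>v\<in>V. a \<bullet> v) = 0"
    using assms(3) by (simp flip: inner_sum_right)
  then have sum: "(\<Sum>v\<in>V. c - a \<bullet> v) = card V * c"
    by (simp add: sum_subtractf)
  have card: "card V > 0"
    using assms by (simp add: card_gt_0_iff)
  have "(\<Sum>v\<in>V. c - a \<bullet> v) \<ge> 0"
    using assms by (intro sum_nonneg) auto
  then show "0 \<le> c"
    using sum card by (simp add: zero_le_mult_iff)
  have "c = 0 \<longleftrightarrow> (\<Sum>v\<in>V. c - a \<bullet> v) = 0"
    using sum card by simp
  also have "\<dots> \<longleftrightarrow> (\<forall>v\<in>V. c - a \<bullet> v = 0)"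
    using assms by (intro sum_nonneg_eq_0_iff) auto
  finally show "c = 0 \<longleftrightarrow> (\<forall>v\<in>V. a \<bullet> v = c)"
    by auto
qed

locale wreath_product =
  fixes P :: "(real ^ 'd) set" and Q :: "(real ^ 'e) set" and w :: "'n::finite \<Rightarrow> real ^ 'e"
  assumes P: "polytope P" and P_vertices: "vertices P \<noteq> {}" "(\<Sum>v\<in>vertices P. v) = 0"
    and Q: "polytope Q"
    and w: "bij_betw w UNIV (vertices Q)"
begin

abbreviation wr where "wr \<equiv> wreath_vertex w :: 'n \<Rightarrow> real ^ 'd \<Rightarrow> _"
abbreviation R where "R \<equiv> wreath_polytope P w"

lemma w_inj: "w j = w k \<longleftrightarrow> j = k"
  using w by (meson UNIV_I bij_betw_def inj_on_eq_iff)

lemma w_vertex: "w k \<in> vertices Q"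
  using w by (auto simp: bij_betw_def)

lemma wr_eq_iff: "wr j u = wr k v \<longleftrightarrow> j = k \<and> u = v"
  by (auto simp: wreath_vertex_def w_inj axis_eq_axis)

lemma inner_wr: "(A, b) \<bullet> wr k v = (A $ k) \<bullet> v + b \<bullet> w k"
  by (simp add: wreath_vertex_def inner_axis)

lemma finite_wr: "finite {wr k v | v k. v \<in> vertices P}"
proof -
  have "{wr k v | v k. v \<in> vertices P} = (\<Union>k. wr k ` vertices P)"
    by blast
  then show ?thesis using finite_vertices[OF P] by simp
qed

lemma polytope_R: "polytope R"
  unfolding polytope_def wreath_polytope_def using finite_wr by blast

text \<open>Let \<open>a\<close> expose \<open>v\<close> in \<open>P\<close> at level
  \<open>d\<close> and let \<open>b\<close> expose \<open>w k\<close> in \<open>Q\<close> at level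
  \<open>c\<close>. Then \<open>(axis k a, b)\<close> has value \<open>d + c\<close> at
  \<open>wr k v\<close>, a smaller value elsewhere in the \<open>k\<close>-th copy because
  \<open>a\<close> drops, and a value below \<open>c\<close> in every other copy. Since
  \<open>d\<close> is nonnegative, the maximum is strict.\<close>

lemma vertices_R: "vertices R = {wr k v | v k. v \<in> vertices P}"
proof
  show "vertices R \<subseteq> {wr k v | v k. v \<in> vertices P}"
    unfolding vertices_def[of R] by (auto simp: wreath_polytope_def dest: extreme_point_of_convex_hull)
  show "{wr k v | v k. v \<in> vertices P} \<subseteq> vertices R"
  proof
    fix x assume x: "x \<in> {wr k v | v k. v \<in> vertices P}"
    then obtain k v where kv: "x = wr k v" "v \<in> vertices P" by auto
    obtain b c where b: "\<forall>u\<in>vertices Q. b \<bullet> u \<le> c" "{w k} = {u\<in>vertices Q. b \<bullet> u = c}"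
      using facial_singleton[OF w_vertex[of k]] unfolding facial_iff_supporting[OF Q] by blast
    obtain a d where a: "\<forall>u\<in>vertices P. a \<bullet> u \<le> d" "{v} = {u\<in>vertices P. a \<bullet> u = d}"
      using facial_singleton[OF kv(2)] unfolding facial_iff_supporting[OF P] by blast
    have d: "0 \<le> d"
      using supporting_level_if_sum_zero(1)[OF finite_vertices[OF P] P_vertices a(1)] .
    have bk: "b \<bullet> w k = c" and av: "a \<bullet> v = d" using a(2) b(2) by blast+
    have bj: "b \<bullet> w j < c" if "j \<noteq> k" for j
    proof -
      have "w j \<notin> {w k}" using that by (simp add: w_inj)
      then have "b \<bullet> w j \<noteq> c" using b(2) w_vertex by blast
      moreover have "b \<bullet> w j \<le> c" using b(1) w_vertex by blast
      ultimately show ?thesis by simp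
    qed
    have au: "a \<bullet> u < d" if "u \<in> vertices P" "u \<noteq> v" for u
    proof -
      have "a \<bullet> u \<noteq> d" using a(2) that by blast
      moreover have "a \<bullet> u \<le> d" using a(1) that by blast
      ultimately show ?thesis by simp
    qed
    have "(axis k a, b) \<bullet> y < (axis k a, b) \<bullet> x"
      if y_mem: "y \<in> {wr k v | v k. v \<in> vertices P}" and "y \<noteq> x" for y
    proof -
      obtain j u where y: "y = wr j u" "u \<in> vertices P" using y_mem by blast
      show ?thesis
      proof (cases "j = k")
        case True
        then show ?thesis using au[of u] y kv that av by (auto simp: inner_wr)
      next
        case False
        then show ?thesis using bj[of j] d y kv av bk by (simp add: inner_wr axis_def)
      qed
    qed
    then have "x extreme_point_of R"
      unfolding wreath_polytope_def
      by (rule extreme_point_of_convex_hull_if_strict_maximum[OF finite_wr x])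
    then show "x \<in> vertices R"
      by (simp add: vertices_def[of R])
  qed
qed

lemma wr_vertex_iff: "wr k v \<in> vertices R \<longleftrightarrow> v \<in> vertices P"
  by (auto simp: vertices_R wr_eq_iff)

lemma vertices_R_cases:
  assumes "x \<in> vertices R"
  obtains k v where "x = wr k v" "v \<in> vertices P"
  using assms by (auto simp: vertices_R)

section \<open>Faces of the wreath product in terms of their fibres\<close>

definition fibre where "fibre S k = {v\<in>vertices P. wr k v \<in> S}"

text \<open>Recorded as vertices of \<open>Q\<close> rather than as indices, so that being a face of
  \<open>Q\<close> can be asked of it directly.\<close>

definition full_fibres where "full_fibres S = w ` {k. fibre S k = vertices P}"

lemma mem_full_fibres: "w k \<in> full_fibres S \<longleftrightarrow> fibre S k = vertices P"
  by (simp add: full_fibres_def image_iff w_inj)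

text \<open>A functional supporting the whole induces level \<open>c - b \<bullet> w k\<close> on
  the \<open>k\<close>-th copy of \<open>P\<close>. For the converse, \<open>b\<close> and
  \<open>c\<close> are chosen first, from the face of \<open>Q\<close>; this prescribes the level on
  each copy, and the functional exposing each fibre is rescaled to meet it.\<close>

lemma facial_R_iff:
  assumes S: "S \<subseteq> vertices R"
  shows "facial R S \<longleftrightarrow> (\<forall>k. facial P (fibre S k)) \<and> facial Q (full_fibres S)"
proof
  assume "facial R S"
  then obtain A b c where le: "\<forall>x\<in>vertices R. (A, b) \<bullet> x \<le> c"
    and S: "S = {x\<in>vertices R. (A, b) \<bullet> x = c}"
    unfolding facial_iff_supporting[OF polytope_R] split_paired_Ex by blast
  have le': "\<forall>v\<in>vertices P. A $ k \<bullet> v \<le> c - b \<bullet> w k" for k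
  proof
    fix v assume "v \<in> vertices P"
    then have "(A, b) \<bullet> wr k v \<le> c" using le by (simp add: wr_vertex_iff)
    then show "A $ k \<bullet> v \<le> c - b \<bullet> w k" by (simp only: inner_wr)
  qed
  have fib: "fibre S k = {v\<in>vertices P. A $ k \<bullet> v = c - b \<bullet> w k}" for k
    by (simp add: S fibre_def wr_vertex_iff inner_wr) force
  have "facial P (fibre S k)" for k
    unfolding facial_iff_supporting[OF P] using le' fib by blast
  moreover have "facial Q (full_fibres S)"
    unfolding facial_iff_supporting[OF Q]
  proof (intro exI conjI ballI)
    \<comment> \<open>Applied to the level of the \<open>k\<close>-th copy: its nonnegativity says
      that \<open>b\<close> supports \<open>Q\<close> at \<open>c\<close>, and its vanishing
      characterises the full fibres.\<close>
    note level = supporting_level_if_sum_zero[OF finite_vertices[OF P] P_vertices le']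
    have onto: "vertices Q = range w" using w by (simp add: bij_betw_def)
    show "b \<bullet> u \<le> c" if "u \<in> vertices Q" for u
      using that level(1) onto by auto
    have "fibre S k = vertices P \<longleftrightarrow> b \<bullet> w k = c" for k
      using level(2)[of k] fib[of k] by auto
    then show "full_fibres S = {u \<in> vertices Q. b \<bullet> u = c}"
      using onto by (auto simp: full_fibres_def)
  qed
  ultimately show "(\<forall>k. facial P (fibre S k)) \<and> facial Q (full_fibres S)" by blast
next
  assume *: "(\<forall>k. facial P (fibre S k)) \<and> facial Q (full_fibres S)"
  then obtain b c where le: "\<forall>u\<in>vertices Q. b \<bullet> u \<le> c"
    and full: "full_fibres S = {u\<in>vertices Q. b \<bullet> u = c}"
    unfolding facial_iff_supporting[OF Q] by blast
  have "\<exists>a. (\<forall>v\<in>vertices P. a \<bullet> v \<le> c - b \<bullet> w k) \<and>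
      fibre S k = {v\<in>vertices P. a \<bullet> v = c - b \<bullet> w k}" for k
  proof (cases "b \<bullet> w k = c")
    case True
    then have "fibre S k = vertices P"
      using w_vertex full mem_full_fibres by blast
    \<comment> \<open>The prescribed level is zero here, and the zero functional selects all
      vertices of \<open>P\<close>.\<close>
    then show ?thesis using True by (intro exI[of _ 0]) auto
  next
    case False
    then have pos: "c - b \<bullet> w k > 0" using le w_vertex[of k] by force
    have nf: "fibre S k \<noteq> vertices P" using False full mem_full_fibres by blast
    obtain a d where a: "\<forall>v\<in>vertices P. a \<bullet> v \<le> d" "fibre S k = {v\<in>vertices P. a \<bullet> v = d}"
      using * unfolding facial_iff_supporting[OF P] by blast
    note level = supporting_level_if_sum_zero[OF finite_vertices[OF P] P_vertices a(1)]
    \<comment> \<open>A supporting functional of level zero would select every vertex of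
      \<open>P\<close>, but this fibre is not full. Hence \<open>d\<close> is positive and positive
      scaling can bring it to the prescribed positive level.\<close>
    have "d \<noteq> 0"
    proof
      assume "d = 0"
      then have "\<forall>v\<in>vertices P. a \<bullet> v = d"
        using level(2) by blast
      then show False
        using a(2) nf by blast
    qed
    then have d: "d > 0"
      using level(1) by simp
    define t where "t = (c - b \<bullet> w k) / d"
    have t: "t > 0" and td: "c - b \<bullet> w k = t * d"
      using pos d by (auto simp: t_def)
    show ?thesis
      unfolding td using a t by (intro exI[of _ "t *\<^sub>R a"]) auto
  qed
  then have "\<exists>a. \<forall>k. (\<forall>v\<in>vertices P. a k \<bullet> v \<le> c - b \<bullet> w k) \<and>
      fibre S k = {v\<in>vertices P. a k \<bullet> v = c - b \<bullet> w k}"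
    by (intro choice allI)
  then obtain a where a: "\<And>k v. v \<in> vertices P \<Longrightarrow> a k \<bullet> v \<le> c - b \<bullet> w k"
    "\<And>k. fibre S k = {v\<in>vertices P. a k \<bullet> v = c - b \<bullet> w k}"
    by blast
  have val: "(\<chi> k. a k, b) \<bullet> wr k v = a k \<bullet> v + b \<bullet> w k" for k v
    by (simp add: inner_wr)
  have "(\<chi> k. a k, b) \<bullet> x \<le> c \<and> ((\<chi> k. a k, b) \<bullet> x = c \<longleftrightarrow> x \<in> S)" if x_mem: "x \<in> vertices R" for x
  proof -
    obtain k v where x: "x = wr k v" "v \<in> vertices P"
      using x_mem by (rule vertices_R_cases)
    have "x \<in> S \<longleftrightarrow> v \<in> fibre S k" using x by (simp add: fibre_def)
    also have "\<dots> \<longleftrightarrow> a k \<bullet> v = c - b \<bullet> w k" using a(2) x(2) by simp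
    finally show ?thesis using a(1)[OF x(2), of k] val[of k v] x(1) by auto
  qed
  then have "(\<forall>x\<in>vertices R. (\<chi> k. a k, b) \<bullet> x \<le> c) \<and>
      S = {x\<in>vertices R. (\<chi> k. a k, b) \<bullet> x = c}"
    using S by blast
  then show "facial R S"
    unfolding facial_iff_supporting[OF polytope_R] by blast
qed

section \<open>The permutation of the indices induced by an automorphism of \<open>Q\<close>\<close>

lemma w_index_perm:
  assumes "h \<in> carrier (aut_group Q)"
  shows "w (index_perm w h k) = h (w k)"
proof -
  have "h (w k) \<in> range w"
    using w aut_group_mem[OF assms w_vertex[of k]] by (simp add: bij_betw_def)
  then show ?thesis
    by (simp add: index_perm_def f_inv_into_f)
qed

lemma bij_index_perm:
  assumes h: "h \<in> carrier (aut_group Q)"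
  shows "bij (index_perm w h)"
proof -
  have "inj (index_perm w h)"
  proof (rule injI)
    fix j k assume "index_perm w h j = index_perm w h k"
    then have "h (w j) = h (w k)"
      using w_index_perm[OF h, of j] w_index_perm[OF h, of k] by simp
    then show "j = k"
      using inj_onD[OF aut_group_inj[OF h]] w_vertex w_inj by blast
  qed
  then show ?thesis
    by (simp add: bij_def finite_UNIV_inj_surj)
qed

lemma index_perm_mult:
  assumes "h \<in> carrier (aut_group Q)" "h' \<in> carrier (aut_group Q)"
  shows "index_perm w (h \<otimes>\<^bsub>aut_group Q\<^esub> h') = index_perm w h \<circ> index_perm w h'"
proof
  fix k
  have "h \<otimes>\<^bsub>aut_group Q\<^esub> h' \<in> carrier (aut_group Q)"
    using assms group_aut_group[OF Q] by (simp add: group.is_monoid monoid.m_closed)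
  then have "w (index_perm w (h \<otimes>\<^bsub>aut_group Q\<^esub> h') k) = w ((index_perm w h \<circ> index_perm w h') k)"
    using assms w_vertex by (simp add: w_index_perm mult_aut_group compose_def)
  then show "index_perm w (h \<otimes>\<^bsub>aut_group Q\<^esub> h') k = (index_perm w h \<circ> index_perm w h') k"
    by (simp add: w_inj)
qed

lemma index_perm_one: "index_perm w \<one>\<^bsub>aut_group Q\<^esub> = id"
proof
  fix k
  have "w (index_perm w \<one>\<^bsub>aut_group Q\<^esub> k) = \<one>\<^bsub>aut_group Q\<^esub> (w k)"
    by (rule w_index_perm[OF monoid.one_closed[OF group.is_monoid[OF group_aut_group[OF Q]]]])
  also have "\<dots> = w k"
    using w_vertex[of k] by (simp add: one_aut_group)
  finally have "w (index_perm w \<one>\<^bsub>aut_group Q\<^esub> k) = w k" .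
  then show "index_perm w \<one>\<^bsub>aut_group Q\<^esub> k = id k"
    by (simp add: w_inj)
qed

section \<open>The wreath product group and its action on the vertices\<close>

abbreviation G where "G \<equiv> wreath_group P w Q"

lemma carrier_G:
  "(g, h) \<in> carrier G \<longleftrightarrow> (\<forall>k. g k \<in> carrier (aut_group P)) \<and> h \<in> carrier (aut_group Q)"
  by (auto simp: wreath_group_def semidirect_product_def)

lemma group_G: "group G"
  unfolding wreath_group_def
proof (rule group_semidirect_product)
  show "group (product_group UNIV (\<lambda>_::'n. aut_group P))"
    using group_aut_group[OF P] by simp
  show "group (aut_group Q)"
    by (rule group_aut_group[OF Q])
next
  fix h h' and g :: "'n \<Rightarrow> real ^ 'd \<Rightarrow> real ^ 'd"
  assume h: "h \<in> carrier (aut_group Q)" "h' \<in> carrier (aut_group Q)"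
  \<comment> \<open>Inversion reverses the composition and precomposing a tuple reverses it once
    more, so shifting coordinates by inverses is a left action.\<close>
  have "inv_into UNIV (index_perm w (h \<otimes>\<^bsub>aut_group Q\<^esub> h'))
      = inv_into UNIV (index_perm w h') \<circ> inv_into UNIV (index_perm w h)"
    using h bij_index_perm by (simp add: index_perm_mult o_inv_distrib)
  then show "(\<lambda>k. g (inv_into UNIV (index_perm w (h \<otimes>\<^bsub>aut_group Q\<^esub> h')) k)) =
      (\<lambda>k. g (inv_into UNIV (index_perm w h') (inv_into UNIV (index_perm w h) k)))"
    by simp
qed (auto simp: hom_def index_perm_one fun_eq_iff)

text \<open>A vertex is decoded into its copy \<open>k\<close> and its point \<open>v\<close>. First
  \<open>h\<close> moves the copy, then the component of \<open>g\<close> at the new index acts, in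
  accordance with the factorisation of \<open>(g, h)\<close> into \<open>g\<close> times
  \<open>h\<close>. Restriction to the vertices makes the map extensional, as \<open>Bij\<close>
  demands.\<close>

definition act :: "('n \<Rightarrow> real ^ 'd \<Rightarrow> real ^ 'd) \<times> (real ^ 'e \<Rightarrow> real ^ 'e) \<Rightarrow>
    (real ^ 'd ^ 'n) \<times> (real ^ 'e) \<Rightarrow> (real ^ 'd ^ 'n) \<times> (real ^ 'e)" where
  "act = (\<lambda>(g, h). \<lambda>x\<in>vertices R. case inv_into UNIV (\<lambda>(k, v). wr k v) x of
     (k, v) \<Rightarrow> wr (index_perm w h k) (g (index_perm w h k) v))"

lemma act_wr:
  "v \<in> vertices P \<Longrightarrow> act (g, h) (wr k v) = wr (index_perm w h k) (g (index_perm w h k) v)"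
proof -
  have "inj (\<lambda>(k, v). wr k v)"
    by (auto simp: inj_on_def wr_eq_iff)
  from inv_f_f[OF this, of "(k, v)"] show "v \<in> vertices P \<Longrightarrow> ?thesis"
    by (simp add: act_def wr_vertex_iff)
qed

lemma act_Bij:
  assumes gh: "(g, h) \<in> carrier G"
  shows "act (g, h) \<in> Bij (vertices R)"
proof -
  have g: "\<And>k. g k \<in> carrier (aut_group P)" and h: "h \<in> carrier (aut_group Q)"
    using gh by (auto simp: carrier_G)
  have "act (g, h) ` vertices R \<subseteq> vertices R"
    using aut_group_mem[OF g]
    by (auto elim!: vertices_R_cases simp: act_wr wr_vertex_iff)
  moreover have "inj_on (act (g, h)) (vertices R)"
  proof (rule inj_onI)
    fix x y assume xy: "x \<in> vertices R" "y \<in> vertices R" "act (g, h) x = act (g, h) y"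
    obtain j u where x: "x = wr j u" "u \<in> vertices P" using xy(1) by (rule vertices_R_cases)
    obtain k v where y: "y = wr k v" "v \<in> vertices P" using xy(2) by (rule vertices_R_cases)
    have "index_perm w h j = index_perm w h k" and
      e: "g (index_perm w h j) u = g (index_perm w h k) v"
      using xy(3) x y by (auto simp: act_wr wr_eq_iff)
    then have "j = k" using bij_index_perm[OF h] by (meson bij_def injD)
    moreover from this have "u = v"
      using e x y aut_group_inj[OF g] by (meson inj_on_eq_iff)
    ultimately show "x = y" using x y by simp
  qed
  ultimately have "bij_betw (act (g, h)) (vertices R) (vertices R)"
    using finite_vertices[OF polytope_R] by (simp add: bij_betw_def endo_inj_surj)
  then show ?thesis by (auto simp: Bij_def act_def)
qed

text \<open>By \<open>facial_R_iff\<close> only fibres matter. The fibre of the image at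
  \<open>index_perm w h k\<close> is the image of the fibre of \<open>S\<close> at \<open>k\<close>
  under an automorphism of \<open>P\<close>, and the set of full fibres is moved by
  \<open>h\<close>, an automorphism of \<open>Q\<close>.\<close>

lemma act_in_aut_group:
  assumes gh: "(g, h) \<in> carrier G"
  shows "act (g, h) \<in> carrier (aut_group R)"
  unfolding aut_group_carrier_iff[OF polytope_R]
proof (intro conjI allI impI)
  show "act (g, h) \<in> Bij (vertices R)" by (rule act_Bij[OF gh])
  have g: "\<And>k. g k \<in> carrier (aut_group P)" and h: "h \<in> carrier (aut_group Q)"
    using gh by (auto simp: carrier_G)
  let ?\<sigma> = "index_perm w h"
  fix S assume S: "S \<subseteq> vertices R"
  have fib: "fibre (act (g, h) ` S) (?\<sigma> k) = g (?\<sigma> k) ` fibre S k" for k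
  proof
    show "g (?\<sigma> k) ` fibre S k \<subseteq> fibre (act (g, h) ` S) (?\<sigma> k)"
    proof (clarify)
      fix v assume "v \<in> fibre S k"
      then have v: "v \<in> vertices P" "wr k v \<in> S" by (auto simp: fibre_def)
      then show "g (?\<sigma> k) v \<in> fibre (act (g, h) ` S) (?\<sigma> k)"
        using aut_group_mem[OF g] act_wr[of v g h k] by (force simp: fibre_def)
    qed
    show "fibre (act (g, h) ` S) (?\<sigma> k) \<subseteq> g (?\<sigma> k) ` fibre S k"
    proof
      fix u assume "u \<in> fibre (act (g, h) ` S) (?\<sigma> k)"
      then obtain x where x: "x \<in> S" "wr (?\<sigma> k) u = act (g, h) x" by (auto simp: fibre_def)
      then obtain j v where v: "x = wr j v" "v \<in> vertices P"
        using S by (meson vertices_R_cases subsetD)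
      then have "?\<sigma> k = ?\<sigma> j" "u = g (?\<sigma> j) v" using x by (auto simp: act_wr wr_eq_iff)
      moreover from this have "k = j" using bij_index_perm[OF h] by (meson bij_def injD)
      ultimately show "u \<in> g (?\<sigma> k) ` fibre S k" using x v by (auto simp: fibre_def)
    qed
  qed
  have sub: "fibre S k \<subseteq> vertices P" for k by (auto simp: fibre_def)
  have surj: "(\<forall>k. A k) \<longleftrightarrow> (\<forall>k. A (?\<sigma> k))" for A
    using bij_index_perm[OF h] by (metis bij_pointE)
  have "(\<forall>k. facial P (fibre (act (g, h) ` S) k)) \<longleftrightarrow>
      (\<forall>k. facial P (g (?\<sigma> k) ` fibre S k))"
    by (subst surj) (simp add: fib)
  also have "\<dots> \<longleftrightarrow> (\<forall>k. facial P (fibre S k))"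
    using g sub by (simp add: aut_group_carrier_iff[OF P])
  finally have 1: "(\<forall>k. facial P (fibre (act (g, h) ` S) k)) \<longleftrightarrow> (\<forall>k. facial P (fibre S k))" .
  \<comment> \<open>Each component of \<open>g\<close> permutes the vertices of \<open>P\<close>, so
    a fibre is full exactly when its image is.\<close>
  have full: "fibre (act (g, h) ` S) (?\<sigma> k) = vertices P \<longleftrightarrow> fibre S k = vertices P" for k
    using fib[of k] aut_group_image[OF g] inj_on_image_eq_iff[OF aut_group_inj[OF g] sub order_refl]
    by metis
  have "full_fibres (act (g, h) ` S) = h ` full_fibres S"
  proof -
    have "{k. fibre (act (g, h) ` S) k = vertices P} = ?\<sigma> ` {k. fibre S k = vertices P}"
    proof (intro equalityI subsetI)
      fix j assume j: "j \<in> {k. fibre (act (g, h) ` S) k = vertices P}"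
      obtain k where "j = ?\<sigma> k"
        using bij_index_perm[OF h] by (metis bij_pointE)
      then show "j \<in> ?\<sigma> ` {k. fibre S k = vertices P}"
        using j full by simp
    qed (use full in auto)
    then show ?thesis
      by (simp add: full_fibres_def image_image w_index_perm[OF h])
  qed
  moreover have "full_fibres S \<subseteq> vertices Q"
    using w_vertex by (auto simp: full_fibres_def)
  ultimately have 2: "facial Q (full_fibres (act (g, h) ` S)) \<longleftrightarrow> facial Q (full_fibres S)"
    using h by (simp add: aut_group_carrier_iff[OF Q])
  have "act (g, h) ` S \<subseteq> vertices R"
    using Bij_imp_funcset[OF act_Bij[OF gh]] S by blast
  then show "facial R (act (g, h) ` S) \<longleftrightarrow> facial R S"
    using facial_R_iff[OF S] facial_R_iff[of "act (g, h) ` S"] 1 2 by simp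
qed

text \<open>Write \<sigma> and \<sigma>' for the index permutations of the two factors. Both sides
  send copy \<open>k\<close> to copy \<sigma>(\<sigma>'(k)). There the product tuple applies
  \<open>g\<close> at this index after the component of \<open>g'\<close> at its preimage under
  \<sigma>, which is \<sigma>'(k), the very component used by the second factor.\<close>

lemma act_mult:
  assumes x: "x \<in> carrier G" and y: "y \<in> carrier G"
  shows "act (x \<otimes>\<^bsub>G\<^esub> y) = compose (vertices R) (act x) (act y)"
proof -
  obtain g h g' h' where xy: "x = (g, h)" "y = (g', h')" by (metis surj_pair)
  have g: "\<And>k. g k \<in> carrier (aut_group P)" and h: "h \<in> carrier (aut_group Q)"
    and g': "\<And>k. g' k \<in> carrier (aut_group P)" and h': "h' \<in> carrier (aut_group Q)"
    using x y xy by (auto simp: carrier_G)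
  have mult: "x \<otimes>\<^bsub>G\<^esub> y = (\<lambda>k. g k \<otimes>\<^bsub>aut_group P\<^esub> g' (inv_into UNIV (index_perm w h) k),
      h \<otimes>\<^bsub>aut_group Q\<^esub> h')"
    by (simp add: xy wreath_group_def semidirect_product_def restrict_UNIV)
  show ?thesis
  proof (rule extensionalityI)
    show "act (x \<otimes>\<^bsub>G\<^esub> y) \<in> extensional (vertices R)"
      by (simp add: mult act_def)
    show "compose (vertices R) (act x) (act y) \<in> extensional (vertices R)"
      by (rule compose_extensional)
    fix z assume z: "z \<in> vertices R"
    then obtain k v where v: "z = wr k v" "v \<in> vertices P" by (rule vertices_R_cases)
    have "inv_into UNIV (index_perm w h) (index_perm w h j) = j" for j
      using bij_index_perm[OF h] by (simp add: bij_def)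
    then show "act (x \<otimes>\<^bsub>G\<^esub> y) z = compose (vertices R) (act x) (act y) z"
      using z v aut_group_mem[OF g' v(2)] unfolding mult
      by (simp add: act_wr xy compose_def index_perm_mult[OF h h'] mult_aut_group[OF g g'])
  qed
qed

text \<open>The motion of the copies determines \<open>h\<close> on the vertices of
  \<open>Q\<close>. As every index is the target of some copy, the motion inside the copies then
  determines each component of \<open>g\<close>. Extensionality turns agreement on vertices into
  equality.\<close>

lemma inj_on_act: "inj_on act (carrier G)"
proof (rule inj_onI)
  fix x y assume x: "x \<in> carrier G" and y: "y \<in> carrier G" and eq: "act x = act y"
  obtain g h g' h' where xy: "x = (g, h)" "y = (g', h')" by (metis surj_pair)
  have g: "\<And>k. g k \<in> carrier (aut_group P)" and h: "h \<in> carrier (aut_group Q)"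
    and g': "\<And>k. g' k \<in> carrier (aut_group P)" and h': "h' \<in> carrier (aut_group Q)"
    using x y xy by (auto simp: carrier_G)
  have e: "index_perm w h k = index_perm w h' k \<and>
      g (index_perm w h k) v = g' (index_perm w h' k) v" if "v \<in> vertices P" for k v
  proof -
    have "act (g, h) (wr k v) = act (g', h') (wr k v)"
      using eq xy by simp
    then show ?thesis
      unfolding act_wr[OF that] wr_eq_iff by auto
  qed
  \<comment> \<open>A vertex of \<open>P\<close> is needed for the copies to contain a point whose
    motion reveals the index permutation.\<close>
  obtain v0 where "v0 \<in> vertices P" using P_vertices by blast
  then have ip: "index_perm w h k = index_perm w h' k" for k using e by blast
  have "h = h'"
  proof (rule extensionalityI)
    show "h \<in> extensional (vertices Q)" "h' \<in> extensional (vertices Q)"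
      using h h' aut_group_subset_Bij Bij_imp_extensional by blast+
    fix u assume "u \<in> vertices Q"
    then obtain k where "u = w k" using w by (auto simp: bij_betw_def)
    then show "h u = h' u" using ip w_index_perm[OF h] w_index_perm[OF h'] by metis
  qed
  moreover have "g k = g' k" for k
  proof (rule extensionalityI)
    show "g k \<in> extensional (vertices P)" "g' k \<in> extensional (vertices P)"
      using g g' aut_group_subset_Bij Bij_imp_extensional by blast+
    fix v assume v: "v \<in> vertices P"
    obtain j where "k = index_perm w h j" using bij_index_perm[OF h] by (metis bij_pointE)
    then show "g k v = g' k v" using e[OF v] by metis
  qed
  ultimately show "x = y" using xy by auto
qed

lemma act_hom_aut_group: "group_hom G (aut_group R) act"
proof -
  have "act \<in> hom G (aut_group R)"
  proof (rule homI)
    show closed: "act x \<in> carrier (aut_group R)" if "x \<in> carrier G" for x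
      using act_in_aut_group that by (cases x) simp
    show "act (x \<otimes>\<^bsub>G\<^esub> y) = act x \<otimes>\<^bsub>aut_group R\<^esub> act y"
      if "x \<in> carrier G" "y \<in> carrier G" for x y
      using that closed by (simp add: act_mult mult_aut_group)
  qed
  then show ?thesis
    using group_G group_aut_group[OF polytope_R] by (simp add: group_hom_def group_hom_axioms_def)
qed

text \<open>An action in the sense of \<open>group_action\<close> is a homomorphism into the full
  permutation group, whereas \<open>act_hom_aut_group\<close> serves to make the image a subgroup of
  the automorphism group.\<close>

lemma act_hom_BijGroup: "group_hom G (BijGroup (vertices R)) act"
proof -
  have "act \<in> hom G (BijGroup (vertices R))"
  proof (rule homI)
    have Bij: "act x \<in> Bij (vertices R)" if "x \<in> carrier G" for x
      using act_Bij that by (cases x) simp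
    then show "act x \<in> carrier (BijGroup (vertices R))" if "x \<in> carrier G" for x
      using that by (simp add: BijGroup_def)
    show "act (x \<otimes>\<^bsub>G\<^esub> y) = act x \<otimes>\<^bsub>BijGroup (vertices R)\<^esub> act y"
      if "x \<in> carrier G" "y \<in> carrier G" for x y
      using that Bij by (simp add: act_mult BijGroup_def)
  qed
  then show ?thesis
    using group_G group_BijGroup by (simp add: group_hom_def group_hom_axioms_def)
qed

lemma faithful_action_act: "faithful_action G (vertices R) act"
  using act_hom_BijGroup inj_on_act
  by (simp add: faithful_action_def faithful_action_axioms_def group_action_def)

text \<open>To move \<open>wr j u\<close> to \<open>wr k v\<close>, take \<open>h\<close> sending
  \<open>w j\<close> to \<open>w k\<close> and \<open>p\<close> sending \<open>u\<close> to
  \<open>v\<close>, and use the constant tuple with entry \<open>p\<close>: the correct component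
  then acts whatever the new index is.\<close>

lemma transitive_action_act_image:
  assumes "transitive_action (aut_group P) (vertices P) (\<lambda>\<pi>. \<pi>)"
    and "transitive_action (aut_group Q) (vertices Q) (\<lambda>\<pi>. \<pi>)"
  shows "transitive_action ((aut_group R)\<lparr>carrier := act ` carrier G\<rparr>) (vertices R) (\<lambda>\<pi>. \<pi>)"
proof (intro transitive_action.intro transitive_action_axioms.intro group_action.intro)
  let ?H = "(aut_group R)\<lparr>carrier := act ` carrier G\<rparr>"
  have sub: "subgroup (act ` carrier G) (BijGroup (vertices R))"
    by (rule group_hom.img_is_subgroup[OF act_hom_BijGroup])
  \<comment> \<open>The automorphism group differs from the full permutation group only in its
    carrier, so overriding the carrier gives the same structure from either.\<close>
  have H: "?H = BijGroup (vertices R)\<lparr>carrier := act ` carrier G\<rparr>"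
    by (simp add: aut_group_def)
  have "group ?H"
    unfolding H by (rule group.subgroup_imp_group[OF group_BijGroup sub])
  moreover have "(\<lambda>\<pi>. \<pi>) \<in> hom ?H (BijGroup (vertices R))"
    unfolding H using subgroup.subset[OF sub] by (auto simp: hom_def)
  ultimately show "group_hom ?H (BijGroup (vertices R)) (\<lambda>\<pi>. \<pi>)"
    using group_BijGroup by (simp add: group_hom_def group_hom_axioms_def)
next
  fix x y assume xy: "x \<in> vertices R" "y \<in> vertices R"
  obtain j u where x: "x = wr j u" "u \<in> vertices P" using xy(1) by (rule vertices_R_cases)
  obtain k v where y: "y = wr k v" "v \<in> vertices P" using xy(2) by (rule vertices_R_cases)
  obtain p where p: "p \<in> carrier (aut_group P)" "p u = v"
    using transitive_action.unique_orbit[OF assms(1)] x y by metis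
  obtain h where h: "h \<in> carrier (aut_group Q)" "h (w j) = w k"
    using transitive_action.unique_orbit[OF assms(2)] w_vertex by metis
  have "index_perm w h j = k"
    using w_index_perm[OF h(1)] h(2) w_inj by metis
  then have "act (\<lambda>_. p, h) x = y"
    using x y p by (simp add: act_wr)
  moreover have "(\<lambda>_. p, h) \<in> carrier G"
    using p h by (simp add: carrier_G)
  ultimately show "\<exists>\<pi>\<in>carrier ((aut_group R)\<lparr>carrier := act ` carrier G\<rparr>). \<pi> x = y"
    by force
qed

end

theorem proposition2p6:
  fixes P :: "(real ^ 'd) set" and Q :: "(real ^ 'e) set" and w :: "'n::finite \<Rightarrow> real ^ 'e"
  assumes "polytope P" and "aff_dim P = int CARD('d)" and "vertex_barycenter P = 0"
    and "polytope Q" and "aff_dim Q = int CARD('e)" and "vertex_barycenter Q = 0"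
    and "bij_betw w UNIV (vertices Q)"
  shows "(\<exists>\<phi>.
            faithful_action (wreath_group P w Q) (vertices (wreath_polytope P w)) \<phi> \<and>
            \<phi> ` carrier (wreath_group P w Q) \<subseteq> carrier (aut_group (wreath_polytope P w)) \<and>
            (\<forall>(g, h) \<in> carrier (wreath_group P w Q). \<forall>k. \<forall>v \<in> vertices P.
               \<phi> (g, h) (wreath_vertex w k v) =
                 wreath_vertex w (index_perm w h k) (g (index_perm w h k) v)))
       \<and> (transitive_action (aut_group P) (vertices P) (\<lambda>\<pi>. \<pi>) \<and>
          transitive_action (aut_group Q) (vertices Q) (\<lambda>\<pi>. \<pi>) \<longrightarrow>
          (\<exists>H. subgroup H (aut_group (wreath_polytope P w)) \<and>
               transitive_action ((aut_group (wreath_polytope P w))\<lparr>carrier := H\<rparr>)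
                 (vertices (wreath_polytope P w)) (\<lambda>\<pi>. \<pi>)))"
proof -
  have fin: "finite (vertices P)"
    by (rule finite_vertices[OF assms(1)])
  \<comment> \<open>The empty set has affine dimension -1, which the dimension assumption excludes.
    A nonempty polytope has a vertex, so the factor in the barycenter is nonzero and the vertex sum
    itself vanishes.\<close>
  have "P \<noteq> {}"
    using assms(2) by auto
  then have ne: "vertices P \<noteq> {}"
    using convex_hull_vertices[OF assms(1)] by force
  have "(\<Sum>v\<in>vertices P. v) = 0"
    using assms(3) fin ne by (simp add: vertex_barycenter_def)
  then interpret wreath_product P Q w
    using assms(1,4,7) ne by unfold_locales
  have "\<exists>\<phi>. faithful_action G (vertices R) \<phi> \<and> \<phi> ` carrier G \<subseteq> carrier (aut_group R) \<and>
      (\<forall>(g, h) \<in> carrier G. \<forall>k. \<forall>v \<in> vertices P.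
        \<phi> (g, h) (wr k v) = wr (index_perm w h k) (g (index_perm w h k) v))"
    using faithful_action_act act_in_aut_group act_wr
    by (intro exI[of _ act] conjI) auto
  \<comment> \<open>The vertex-transitive subgroup is the image of the wreath product group under
    \<open>act\<close>.\<close>
  then show ?thesis
    using group_hom.img_is_subgroup[OF act_hom_aut_group] transitive_action_act_image by blast
qed

end
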